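(* Let $G$ be an abelian group which is free of 2-torsion, $g_0\in G$, and let $\mathcal P=\bigoplus_{g\in G}\mathcal P_g$ be a Poisson color algebra of degree $g_0$ over a field $\mathbb K$ whose restricted support $\Sigma$ is symmetric. Suppose that $\mathcal P$ is centerless, $\Sigma$-multiplicative, of maximal length, and that $\mathcal P_\beta$ is tight for every $\beta\in\{0,\pm g_0,\pm2g_0,-3g_0\}$. Then $\mathcal P$ is simple if and only if any two elements of $\Sigma$ are connected.
   Context: $\mathbb K$ is an arbitrary field, $(G,+)$ an abelian group; all algebras have arbitrary dimension. "Free of 2-torsion" means $2x=0$ implies $x=0$ in $G$. A skew-symmetric bicharacter of $G$ is a map $\epsilon:G\times G\to\mathbb K\setminus\{0\}$ with $\epsilon(a,b)=\epsilon(b,a)^{-1}$ and $\epsilon(a,b+c)=\epsilon(a,b)\epsilon(a,c)$. Poisson color algebra of degree $g_0\in G$ (with respect to $\epsilon$): a $G$-graded $\mathbb K$-vector space $\mathcal P=\bigoplus_{g\in G}\mathcal P_g$ with a bilinear product $\{\cdot,\cdot\}$ satisfying $\{\mathcal P_g,\mathcal P_h\}\subset\mathcal P_{g+h+g_0}$ and, for homogeneous $x,y,z$ of degrees $|x|,|y|,|z|$, $\{x,y\}=-\epsilon(|x|+g_0,|y|+g_0)\{y,x\}$ and $\{x,\{y,z\}\}=\{\{x,y\},z\}+\epsilon(|x|+g_0,|y|+g_0)\{y,\{x,z\}\}$; together with a bilinear associative product (juxtaposition) satisfying $\mathcal P_g\mathcal P_h\subset\mathcal P_{g+h}$, $xy=\epsilon(|x|,|y|)yx$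 and $\{x,yz\}=\{x,y\}z+\epsilon(|x|+g_0,|y|)y\{x,z\}$ for homogeneous $x,y,z$. Products $\{A,B\}$ and $AB$ of subspaces denote linear spans of products of elements. A subalgebra is a graded linear subspace $\mathcal Q$ with $\{\mathcal Q,\mathcal Q\}+\mathcal Q\mathcal Q\subset\mathcal Q$; an ideal is a subalgebra $\mathcal I$ (in particular graded) with $\{\mathcal I,\mathcal P\}+\{\mathcal P,\mathcal I\}+\mathcal I\mathcal P+\mathcal P\mathcal I\subset\mathcal I$. $\mathcal P$ is simple if $\{\mathcal P,\mathcal P\}\neq0$, $\mathcal P\mathcal P\neq0$ and its only ideals are $\{0\}$ and $\mathcal P$. The center of $\mathcal P$ is $\{v\in\mathcal P:\{v,\mathcal P\}+\{\mathcal P,v\}+v\mathcal P+\mathcal Pv=0\}$; $\mathcal P$ is centerless if its center is $0$. Restricted support: $\Sigma=\{g\in G:\mathcal P_g\neq0\}\setminus\{0,\pm g_0\}$; $-\Sigma=\{-g:g\in\Sigma\}$, $\pm\Sigma=\Sigma\cup(-\Sigma)$. $\Sigma$ is symmetric if $g\in\Sigma$ implies $-g\in\Sigma$. Connection: for $g,h\in\Sigma$, $g$ is connected to $h$ if there exist $n\ge1$, $g_1,\dots,g_n\in\pm\Sigma\cup\{0,\pm g_0\}$ and $k_2,\dots,k_n\in\{0,\pm g_0\}$ such that $g_1=g$; for each $2\le m\le n-1$, $g_1+(g_2+k_2)+\cdots+(g_m+k_m)\in\pm\Sigma$; and $g_1+(g_2+k_2)+\cdots+(g_n+k_n)\in\{h,-h\}$.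 Tightness: for $\alpha\in\{\pm ng_0:n=0,1,2,3\}$, $\mathcal P_\alpha$ is tight if, with $\Sigma'=\Sigma\setminus\{\pm2g_0,\pm3g_0\}$, $$\mathcal P_\alpha=\sum_{\substack{h,p\in\Sigma'\\ p=-h-g_0+\alpha}}\{\mathcal P_h,\mathcal P_p\}+\sum_{\substack{k,q\in\Sigma'\\ q=-k+\alpha}}\mathcal P_k\mathcal P_q.$$ Maximal length: $\mathcal P_0\neq0$ and $\dim\mathcal P_g=1$ for every $g\in\Sigma$. $\Sigma$-multiplicative: whenever $g\in\Sigma$, $h\in\Sigma\cup\{0,\pm g_0\}$ and $k\in\{0,g_0,-g_0\}$ satisfy $g+h+k\in\Sigma$, then $\mathcal P_g\mathcal P_h\neq0$ if $k=0$, $\{\mathcal P_g,\mathcal P_h\}\neq0$ if $k=g_0$, and $(\mathcal P_g\mathcal P_h)\mathcal P_{-g_0}\neq0$ if $k=-g_0$. *)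

theory Defs
  imports Complex_Main
begin

definition free_of_two_torsion :: "'g::ab_group_add itself \<Rightarrow> bool" where
  "free_of_two_torsion _ \<longleftrightarrow> (\<forall>x::'g. x + x = 0 \<longrightarrow> x = 0)"

definition skew_symmetric_bicharacter ::
    "('g::ab_group_add \<Rightarrow> 'g \<Rightarrow> 'k::field) \<Rightarrow> bool" where
  "skew_symmetric_bicharacter \<epsilon> \<longleftrightarrow>
     (\<forall>a b. \<epsilon> a b \<noteq> 0) \<and>
     (\<forall>a b. \<epsilon> a b = inverse (\<epsilon> b a)) \<and>
     (\<forall>a b c. \<epsilon> a (b + c) = \<epsilon> a b * \<epsilon> a c)"

text \<open>The algebra is the whole type \<open>'v\<close>, a vector space over the field \<open>'k\<close> with
  scalar multiplication \<open>scale\<close>; \<open>P g\<close> is the homogeneous component of degree \<open>g\<close>.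
  The last two assumptions say that the components span \<open>'v\<close> and are independent,
  i.e. that \<open>'v\<close> is their direct sum.\<close>

locale graded_vector_space = vector_space scale
  for scale :: "'k::field \<Rightarrow> 'v::ab_group_add \<Rightarrow> 'v" +
  fixes P :: "'g::ab_group_add \<Rightarrow> 'v set"
  assumes subspace_component: "subspace (P g)"
    and span_components: "span (\<Union>g. P g) = UNIV"
    and independent_components:
      "finite S \<Longrightarrow> (\<And>g. g \<in> S \<Longrightarrow> x g \<in> P g) \<Longrightarrow> (\<Sum>g\<in>S. x g) = 0
       \<Longrightarrow> g \<in> S \<Longrightarrow> x g = 0"

text \<open>\<open>br\<close> is the Poisson bracket and \<open>mul\<close> the associative product.\<close>

locale poisson_color_algebra = graded_vector_space scale P
  for scale :: "'k::field \<Rightarrow> 'v::ab_group_add \<Rightarrow> 'v"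
    and P :: "'g::ab_group_add \<Rightarrow> 'v set" +
  fixes \<epsilon> :: "'g \<Rightarrow> 'g \<Rightarrow> 'k"
    and g0 :: 'g
    and br :: "'v \<Rightarrow> 'v \<Rightarrow> 'v"
    and mul :: "'v \<Rightarrow> 'v \<Rightarrow> 'v"
  assumes bicharacter: "skew_symmetric_bicharacter \<epsilon>"
    and br_linear_right: "Vector_Spaces.linear scale scale (\<lambda>y. br x y)"
    and br_linear_left: "Vector_Spaces.linear scale scale (\<lambda>x. br x y)"
    and br_degree: "x \<in> P g \<Longrightarrow> y \<in> P h \<Longrightarrow> br x y \<in> P (g + h + g0)"
    and br_skew: "x \<in> P g \<Longrightarrow> y \<in> P h \<Longrightarrow>
      br x y = - scale (\<epsilon> (g + g0) (h + g0)) (br y x)"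
    and br_jacobi: "x \<in> P g \<Longrightarrow> y \<in> P h \<Longrightarrow> z \<in> P l \<Longrightarrow>
      br x (br y z) = br (br x y) z + scale (\<epsilon> (g + g0) (h + g0)) (br y (br x z))"
    and mul_linear_right: "Vector_Spaces.linear scale scale (\<lambda>y. mul x y)"
    and mul_linear_left: "Vector_Spaces.linear scale scale (\<lambda>x. mul x y)"
    and mul_assoc: "mul (mul x y) z = mul x (mul y z)"
    and mul_degree: "x \<in> P g \<Longrightarrow> y \<in> P h \<Longrightarrow> mul x y \<in> P (g + h)"
    and mul_color_commute: "x \<in> P g \<Longrightarrow> y \<in> P h \<Longrightarrow>
      mul x y = scale (\<epsilon> g h) (mul y x)"
    and leibniz: "x \<in> P g \<Longrightarrow> y \<in> P h \<Longrightarrow> z \<in> P l \<Longrightarrow>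
      br x (mul y z) = mul (br x y) z + scale (\<epsilon> (g + g0) h) (mul y (br x z))"

definition span_prod ::
    "('k::field \<Rightarrow> 'v::ab_group_add \<Rightarrow> 'v) \<Rightarrow> ('v \<Rightarrow> 'v \<Rightarrow> 'v) \<Rightarrow> 'v set \<Rightarrow> 'v set \<Rightarrow> 'v set" where
  "span_prod scale f A B = module.span scale {f a b | a b. a \<in> A \<and> b \<in> B}"

definition graded_subspace ::
    "('k::field \<Rightarrow> 'v::ab_group_add \<Rightarrow> 'v) \<Rightarrow> ('g::ab_group_add \<Rightarrow> 'v set) \<Rightarrow> 'v set \<Rightarrow> bool" where
  "graded_subspace scale P Q \<longleftrightarrow>
     module.subspace scale Q \<and> Q = module.span scale (\<Union>g. Q \<inter> P g)"

definition pca_subalgebra ::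
    "('k::field \<Rightarrow> 'v::ab_group_add \<Rightarrow> 'v) \<Rightarrow> ('g::ab_group_add \<Rightarrow> 'v set) \<Rightarrow>
     ('v \<Rightarrow> 'v \<Rightarrow> 'v) \<Rightarrow> ('v \<Rightarrow> 'v \<Rightarrow> 'v) \<Rightarrow> 'v set \<Rightarrow> bool" where
  "pca_subalgebra scale P br mul Q \<longleftrightarrow>
     graded_subspace scale P Q \<and>
     span_prod scale br Q Q \<subseteq> Q \<and> span_prod scale mul Q Q \<subseteq> Q"

definition pca_ideal ::
    "('k::field \<Rightarrow> 'v::ab_group_add \<Rightarrow> 'v) \<Rightarrow> ('g::ab_group_add \<Rightarrow> 'v set) \<Rightarrow>
     ('v \<Rightarrow> 'v \<Rightarrow> 'v) \<Rightarrow> ('v \<Rightarrow> 'v \<Rightarrow> 'v) \<Rightarrow> 'v set \<Rightarrow> bool" where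
  "pca_ideal scale P br mul I \<longleftrightarrow>
     pca_subalgebra scale P br mul I \<and>
     span_prod scale br I UNIV \<subseteq> I \<and> span_prod scale br UNIV I \<subseteq> I \<and>
     span_prod scale mul I UNIV \<subseteq> I \<and> span_prod scale mul UNIV I \<subseteq> I"

definition pca_simple ::
    "('k::field \<Rightarrow> 'v::ab_group_add \<Rightarrow> 'v) \<Rightarrow> ('g::ab_group_add \<Rightarrow> 'v set) \<Rightarrow>
     ('v \<Rightarrow> 'v \<Rightarrow> 'v) \<Rightarrow> ('v \<Rightarrow> 'v \<Rightarrow> 'v) \<Rightarrow> bool" where
  "pca_simple scale P br mul \<longleftrightarrow>
     span_prod scale br UNIV UNIV \<noteq> {0} \<and>
     span_prod scale mul UNIV UNIV \<noteq> {0} \<and>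
     (\<forall>I. pca_ideal scale P br mul I \<longrightarrow> I = {0} \<or> I = UNIV)"

definition pca_center ::
    "('v::ab_group_add \<Rightarrow> 'v \<Rightarrow> 'v) \<Rightarrow> ('v \<Rightarrow> 'v \<Rightarrow> 'v) \<Rightarrow> 'v set" where
  "pca_center br mul =
     {v. \<forall>x. br v x = 0 \<and> br x v = 0 \<and> mul v x = 0 \<and> mul x v = 0}"

definition centerless ::
    "('v::ab_group_add \<Rightarrow> 'v \<Rightarrow> 'v) \<Rightarrow> ('v \<Rightarrow> 'v \<Rightarrow> 'v) \<Rightarrow> bool" where
  "centerless br mul \<longleftrightarrow> pca_center br mul = {0}"

definition restricted_support ::
    "('g::ab_group_add \<Rightarrow> 'v::ab_group_add set) \<Rightarrow> 'g \<Rightarrow> 'g set" where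
  "restricted_support P g0 = {g. P g \<noteq> {0}} - {0, g0, - g0}"

definition pm_support ::
    "('g::ab_group_add \<Rightarrow> 'v::ab_group_add set) \<Rightarrow> 'g \<Rightarrow> 'g set" where
  "pm_support P g0 = restricted_support P g0 \<union> uminus ` restricted_support P g0"

definition symmetric_support ::
    "('g::ab_group_add \<Rightarrow> 'v::ab_group_add set) \<Rightarrow> 'g \<Rightarrow> bool" where
  "symmetric_support P g0 \<longleftrightarrow>
     (\<forall>g \<in> restricted_support P g0. - g \<in> restricted_support P g0)"

text \<open>Only the values \<open>a 1, \<dots>, a n\<close> and \<open>k 2, \<dots>, k n\<close> of the two sequences matter.\<close>

definition support_connected ::
    "('g::ab_group_add \<Rightarrow> 'v::ab_group_add set) \<Rightarrow> 'g \<Rightarrow> 'g \<Rightarrow> 'g \<Rightarrow> bool" where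
  "support_connected P g0 g h \<longleftrightarrow>
     (\<exists>(n::nat) (a::nat \<Rightarrow> 'g) (k::nat \<Rightarrow> 'g).
        n \<ge> 1 \<and>
        (\<forall>i \<in> {1..n}. a i \<in> pm_support P g0 \<union> {0, g0, - g0}) \<and>
        (\<forall>i \<in> {2..n}. k i \<in> {0, g0, - g0}) \<and>
        a 1 = g \<and>
        (\<forall>m \<in> {2..n - 1}. a 1 + (\<Sum>i = 2..m. a i + k i) \<in> pm_support P g0) \<and>
        a 1 + (\<Sum>i = 2..n. a i + k i) \<in> {h, - h})"

definition tight_support ::
    "('g::ab_group_add \<Rightarrow> 'v::ab_group_add set) \<Rightarrow> 'g \<Rightarrow> 'g set" where
  "tight_support P g0 = restricted_support P g0 -
     {g0 + g0, - (g0 + g0), g0 + g0 + g0, - (g0 + g0 + g0)}"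

text \<open>The sum of a family of subspaces is the span of its union; the empty sum is \<open>{0}\<close>.\<close>

definition tight ::
    "('k::field \<Rightarrow> 'v::ab_group_add \<Rightarrow> 'v) \<Rightarrow> ('g::ab_group_add \<Rightarrow> 'v set) \<Rightarrow> 'g \<Rightarrow>
     ('v \<Rightarrow> 'v \<Rightarrow> 'v) \<Rightarrow> ('v \<Rightarrow> 'v \<Rightarrow> 'v) \<Rightarrow> 'g \<Rightarrow> bool" where
  "tight scale P g0 br mul \<alpha> \<longleftrightarrow>
     P \<alpha> = module.span scale
       (\<Union> {span_prod scale br (P h) (P p) | h p.
              h \<in> tight_support P g0 \<and> p \<in> tight_support P g0 \<and> p = - h - g0 + \<alpha>} \<union>
        \<Union> {span_prod scale mul (P k) (P q) | k q.
              k \<in> tight_support P g0 \<and> q \<in> tight_support P g0 \<and> q = - k + \<alpha>})"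

definition maximal_length ::
    "('k::field \<Rightarrow> 'v::ab_group_add \<Rightarrow> 'v) \<Rightarrow> ('g::ab_group_add \<Rightarrow> 'v set) \<Rightarrow> 'g \<Rightarrow> bool" where
  "maximal_length scale P g0 \<longleftrightarrow>
     P 0 \<noteq> {0} \<and> (\<forall>g \<in> restricted_support P g0. vector_space.dim scale (P g) = 1)"

text \<open>The three cases for \<open>k\<close> are separate implications: they overlap when \<open>g0 = 0\<close>,
  and then all three conclusions are required.\<close>

definition support_multiplicative ::
    "('k::field \<Rightarrow> 'v::ab_group_add \<Rightarrow> 'v) \<Rightarrow> ('g::ab_group_add \<Rightarrow> 'v set) \<Rightarrow> 'g \<Rightarrow>
     ('v \<Rightarrow> 'v \<Rightarrow> 'v) \<Rightarrow> ('v \<Rightarrow> 'v \<Rightarrow> 'v) \<Rightarrow> bool" where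
  "support_multiplicative scale P g0 br mul \<longleftrightarrow>
     (\<forall>g \<in> restricted_support P g0.
      \<forall>h \<in> restricted_support P g0 \<union> {0, g0, - g0}.
      \<forall>k \<in> {0, g0, - g0}.
        g + h + k \<in> restricted_support P g0 \<longrightarrow>
          (k = 0 \<longrightarrow> span_prod scale mul (P g) (P h) \<noteq> {0}) \<and>
          (k = g0 \<longrightarrow> span_prod scale br (P g) (P h) \<noteq> {0}) \<and>
          (k = - g0 \<longrightarrow>
             span_prod scale mul (span_prod scale mul (P g) (P h)) (P (- g0)) \<noteq> {0}))"

end

theory Submission
  imports Defs
begin

text \<open>Call \<open>x\<close> and \<open>y\<close> orthogonal if all four products of \<open>x\<close> and \<open>y\<close> vanish. By the Jacobi
  identity, the Leibniz rule and associativity, the homogeneous elements orthogonal to a given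
  homogeneous element are closed under both products.

  Components whose degrees lie in different connection classes are orthogonal. If a class \<open>C\<close> is
  not all of \<open>\<Sigma>\<close>, let \<open>K\<close> be the set of homogeneous elements orthogonal to all \<open>P d\<close> with
  \<open>d \<in> \<Sigma> - C\<close>. By tightness the algebra is spanned by \<open>K\<close> together with elements orthogonal to \<open>K\<close>,
  so the span of \<open>K\<close> is an ideal; it is nonzero, and if it were everything then \<open>P d\<close>
  would be central.

  Conversely, an ideal that meets no \<open>P g\<close> with \<open>g \<in> \<Sigma>\<close> is orthogonal to all components, first to
  those with degree outside \<open>{0, \<plusminus>g0, \<plusminus>2g0, -3g0}\<close> for reasons of degree and then to the remaining
  ones by tightness, so it is zero because there is no center. Any other ideal contains some \<open>P g\<close>, hence by
  multiplicativity along connections one of \<open>P h\<close>, \<open>P (- h)\<close> for every \<open>h \<in> \<Sigma>\<close>. Tightness then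
  gives \<open>P 0\<close>, and \<open>P h\<close> is recovered from the nonzero product of \<open>P h\<close> and \<open>P 0\<close>.\<close>

section \<open>Connections and degree arithmetic\<close>

lemma support_connected_refl: "support_connected P g0 g g" if "g \<in> restricted_support P g0"
  unfolding support_connected_def
  by (rule exI[of _ 1], rule exI[of _ "\<lambda>_. g"], rule exI[of _ "\<lambda>_. 0"])
     (use that in \<open>auto simp: pm_support_def\<close>)

lemma support_connected_uminus: "support_connected P g0 g (- h) \<longleftrightarrow> support_connected P g0 g h"
  unfolding support_connected_def by (simp add: insert_commute)

lemma pm_support_symmetric:
  assumes "symmetric_support P g0"
  shows "pm_support P g0 = restricted_support P g0"
  using assms unfolding pm_support_def symmetric_support_def by auto

text \<open>A connection from \<open>g\<close> to \<open>u\<close> ends at \<open>u\<close> or at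
  \<open>- u\<close>. Appending the pair \<open>b\<close>, \<open>l\<close> in the first case and
  \<open>- b\<close>, \<open>- l\<close> in the second ends at \<open>u + b + l\<close> up to sign,
  which is all that a connection requires.\<close>

lemma support_connected_step:
  fixes P :: "'a::ab_group_add \<Rightarrow> 'v::ab_group_add set"
  assumes sym: "symmetric_support P g0"
    and con: "support_connected P g0 g u"
    and u: "u \<in> restricted_support P g0"
    and b: "b \<in> restricted_support P g0 \<union> {0, g0, - g0}"
    and l: "l \<in> {0, g0, - g0}"
  shows "support_connected P g0 g (u + b + l)"
proof -
  note pm = pm_support_symmetric[OF sym]
  have neg: "- x \<in> restricted_support P g0" if "x \<in> restricted_support P g0" for x
    using sym that by (simp add: symmetric_support_def)
  obtain n :: nat and a k :: "nat \<Rightarrow> 'a" where n: "n \<ge> 1"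
    and a: "\<forall>i \<in> {1..n}. a i \<in> pm_support P g0 \<union> {0, g0, - g0}"
    and k: "\<forall>i \<in> {2..n}. k i \<in> {0, g0, - g0}"
    and a1: "a 1 = g"
    and mid: "\<forall>m \<in> {2..n - 1}. a 1 + (\<Sum>i = 2..m. a i + k i) \<in> pm_support P g0"
    and last: "a 1 + (\<Sum>i = 2..n. a i + k i) \<in> {u, - u}"
    using con unfolding support_connected_def by blast
  define s where "s = a 1 + (\<Sum>i = 2..n. a i + k i)"
  obtain b' l' where b': "b' \<in> pm_support P g0 \<union> {0, g0, - g0}" and l': "l' \<in> {0, g0, - g0}"
    and sum: "s + (b' + l') \<in> {u + b + l, - (u + b + l)}"
  proof (cases "s = u")
    case True
    then show ?thesis using b l by (intro that[of b l]) (auto simp: pm add.assoc)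
  next
    case False
    then have "s = - u" using last by (auto simp: s_def)
    then show ?thesis using b l neg
      by (intro that[of "- b" "- l"]) (auto simp: pm algebra_simps)
  qed
  define a' where "a' = a(Suc n := b')"
  define k' where "k' = k(Suc n := l')"
  have eq: "a' 1 + (\<Sum>i = 2..m. a' i + k' i) = a 1 + (\<Sum>i = 2..m. a i + k i)" if "m \<le> n" for m
    using that n by (auto simp: a'_def k'_def intro!: sum.cong)
  have "a' 1 + (\<Sum>i = 2..Suc n. a' i + k' i) = s + (b' + l')"
  proof -
    have "(\<Sum>i = 2..Suc n. a' i + k' i) = (\<Sum>i = 2..n. a' i + k' i) + (b' + l')"
      using n by (simp add: a'_def k'_def)
    then show ?thesis using eq[of n] by (simp add: s_def add.assoc[symmetric])
  qed
  \<comment> \<open>The old endpoint \<open>m = n\<close> becomes an intermediate sum. This is where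
    \<open>u\<close> must lie in the restricted support.\<close>
  moreover have "a' 1 + (\<Sum>i = 2..m. a' i + k' i) \<in> pm_support P g0" if "m \<in> {2..n}" for m
  proof (cases "m = n")
    case True
    then show ?thesis using eq[of m] last u neg by (auto simp: pm)
  next
    case False
    then show ?thesis using eq[of m] mid that by auto
  qed
  moreover have "\<forall>i \<in> {1..Suc n}. a' i \<in> pm_support P g0 \<union> {0, g0, - g0}"
    using a b' by (auto simp: a'_def)
  moreover have "\<forall>i \<in> {2..Suc n}. k' i \<in> {0, g0, - g0}"
    using k l' by (auto simp: k'_def)
  moreover have "a' 1 = g" using a1 n by (simp add: a'_def)
  moreover have "Suc n \<ge> 1" "Suc n - 1 = n" by simp_all
  ultimately show ?thesis
    unfolding support_connected_def
    by - (rule exI[of _ "Suc n"], rule exI[of _ a'], rule exI[of _ k'], use sum in simp)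
qed

text \<open>Used contrapositively: for \<open>b\<close> off this list, both products of components
  of degrees \<open>a\<close> and \<open>b\<close> have degree outside \<open>{0, g0, - g0}\<close>.
  The list is asymmetric because the bracket adds \<open>g0\<close> to the degree, so solving for
  \<open>b\<close> shifts only towards \<open>- (g0 + g0 + g0)\<close>.\<close>

lemma near_zero_shift:
  fixes g0 :: "'a::ab_group_add"
  assumes a: "a \<in> {0, g0, - g0}"
    and b: "b + a \<in> {0, g0, - g0} \<or> b + a + g0 \<in> {0, g0, - g0}"
  shows "b \<in> {0, g0, - g0, g0 + g0, - (g0 + g0), - (g0 + g0 + g0)}"
proof -
  obtain s where s: "s \<in> {0, g0, - g0}" and "b + a = s \<or> b + a + g0 = s"
    using b by blast
  then have "b = s - a \<or> b = s - a - g0" by (auto simp: algebra_simps)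
  moreover have d: "s - a \<in> {0, g0, - g0, g0 + g0, - g0 - g0}" using s a by auto
  moreover have "s - a - g0 \<in> {0, g0, - g0, - g0 - g0, - g0 - g0 - g0}" using d by auto
  moreover have "- g0 - g0 = - (g0 + g0)" "- g0 - g0 - g0 = - (g0 + g0 + g0)" by simp_all
  ultimately show ?thesis by (metis insert_iff)
qed

lemma tight_support_subset: "tight_support P g0 \<subseteq> restricted_support P g0"
  by (auto simp: tight_support_def)

section \<open>Spans of products and one-dimensional components\<close>

context vector_space
begin

lemma span_prod_nonzeroE:
  assumes "span_prod scale f A B \<noteq> {0}"
  obtains a b where "a \<in> A" "b \<in> B" "f a b \<noteq> 0"
proof -
  have "\<not> {f a b | a b. a \<in> A \<and> b \<in> B} \<subseteq> {0}"
  proof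
    assume "{f a b | a b. a \<in> A \<and> b \<in> B} \<subseteq> {0}"
    then have "span {f a b | a b. a \<in> A \<and> b \<in> B} \<subseteq> {0}"
      by (rule span_minimal) (simp add: subspace_single_0)
    with assms span_zero show False unfolding span_prod_def by blast
  qed
  then show ?thesis using that by blast
qed

lemma span_prod_nonzeroI:
  assumes "a \<in> A" "b \<in> B" "f a b \<noteq> 0"
  shows "span_prod scale f A B \<noteq> {0}"
proof -
  have "f a b \<in> span_prod scale f A B"
    unfolding span_prod_def using assms by (blast intro: span_base)
  with assms(3) show ?thesis by blast
qed

lemma span_prod_subsetI:
  assumes "subspace I" "\<And>a b. a \<in> A \<Longrightarrow> b \<in> B \<Longrightarrow> f a b \<in> I"
  shows "span_prod scale f A B \<subseteq> I"
  unfolding span_prod_def using assms by (intro span_minimal) auto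

lemma span_prod_base: "a \<in> A \<Longrightarrow> b \<in> B \<Longrightarrow> f a b \<in> span_prod scale f A B"
  unfolding span_prod_def by (rule span_base) blast

text \<open>\<open>S\<close> lies on the line through a single basis vector, and the nonzero
  \<open>x\<close> is an invertible multiple of that vector. This lets one nonzero element put a
  whole component into an ideal.\<close>

lemma dim_one_subset:
  assumes "dim S = 1" "x \<in> S" "x \<noteq> 0" "subspace V" "x \<in> V"
  shows "S \<subseteq> V"
proof -
  obtain B where B: "S \<subseteq> span B" "card B = dim S"
    using basis_exists by metis
  then obtain b where b: "B = {b}" using assms(1) by (metis card_1_singletonE)
  obtain c where c: "x = c *s b" using B(1) b assms(2) by (auto simp: span_singleton)
  then have "c \<noteq> 0" using assms(3) by auto
  then have "b = inverse c *s x" by (simp add: c)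
  then have "b \<in> V" using assms(4,5) by (simp add: subspace_scale)
  then have "span B \<subseteq> V" using b assms(4) by (intro span_minimal) auto
  with B(1) show ?thesis by blast
qed

end

section \<open>Orthogonality of homogeneous elements\<close>

context poisson_color_algebra
begin

sublocale br_right: Vector_Spaces.linear scale scale "\<lambda>y. br x y" for x
  by (rule br_linear_right)

sublocale br_left: Vector_Spaces.linear scale scale "\<lambda>x. br x y" for y
  by (rule br_linear_left)

sublocale mul_right: Vector_Spaces.linear scale scale "\<lambda>y. mul x y" for x
  by (rule mul_linear_right)

sublocale mul_left: Vector_Spaces.linear scale scale "\<lambda>x. mul x y" for y
  by (rule mul_linear_left)

lemmas bilinear_simps =
  br_right.zero br_left.zero mul_right.zero mul_left.zero
  br_right.add br_left.add mul_right.add mul_left.add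
  br_right.scale br_left.scale mul_right.scale mul_left.scale

definition orthogonal :: "'v \<Rightarrow> 'v \<Rightarrow> bool" where
  "orthogonal x y \<longleftrightarrow> br x y = 0 \<and> br y x = 0 \<and> mul x y = 0 \<and> mul y x = 0"

lemma orthogonal_sym: "orthogonal x y \<longleftrightarrow> orthogonal y x"
  by (auto simp: orthogonal_def)

lemma subspace_orthogonal: "subspace {y. orthogonal x y}"
  by (auto simp: subspace_def orthogonal_def bilinear_simps)

lemma orthogonal_span:
  assumes "\<And>y. y \<in> S \<Longrightarrow> orthogonal x y" "y \<in> span S"
  shows "orthogonal x y"
  using span_minimal[OF _ subspace_orthogonal[of x], of S] assms by blast

lemma orthogonal_homogeneousI:
  assumes "x \<in> P g" "y \<in> P h" "br x y = 0" "mul x y = 0"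
  shows "orthogonal x y"
  using br_skew[OF assms(2,1)] mul_color_commute[OF assms(2,1)] assms(3,4)
  by (simp add: orthogonal_def)

text \<open>In the Jacobi identity and in the Leibniz rule for \<open>x\<close>, \<open>y\<close>,
  \<open>z\<close>, every term except the one containing \<open>br x y\<close> has a vanishing inner
  product with \<open>z\<close>.\<close>

lemma orthogonal_br:
  assumes "x \<in> P g" "y \<in> P h" "z \<in> P l" "orthogonal x z" "orthogonal y z"
  shows "orthogonal (br x y) z"
proof (rule orthogonal_homogeneousI)
  show "br x y \<in> P (g + h + g0)" using assms by (simp add: br_degree)
  show "br (br x y) z = 0"
    using br_jacobi[OF assms(1-3)] assms(4,5) by (simp add: orthogonal_def bilinear_simps)
  show "mul (br x y) z = 0"
    using leibniz[OF assms(1-3)] assms(4,5) by (simp add: orthogonal_def bilinear_simps)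
qed fact

lemma orthogonal_mul:
  assumes "x \<in> P g" "y \<in> P h" "z \<in> P l" "orthogonal x z" "orthogonal y z"
  shows "orthogonal (mul x y) z"
  \<comment> \<open>With \<open>z\<close> on the left, the Leibniz rule expands
    \<open>br z (mul x y)\<close> into terms with \<open>br z x\<close> and \<open>br z y\<close>,
    and associativity exposes \<open>mul z x\<close>.\<close>
  unfolding orthogonal_sym[of _ z]
proof (rule orthogonal_homogeneousI)
  show "mul x y \<in> P (g + h)" using assms by (simp add: mul_degree)
  show "br z (mul x y) = 0"
    using leibniz[OF assms(3,1,2)] assms(4,5) by (simp add: orthogonal_def bilinear_simps)
  show "mul z (mul x y) = 0"
    using assms(4,5) by (simp add: mul_assoc[symmetric] orthogonal_def bilinear_simps)
qed fact

text \<open>Only homogeneous elements are collected, since the identities behind closure under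
  products hold for those. The result is therefore a generating set and not a subspace.\<close>

definition orthogonal_set :: "'v set \<Rightarrow> 'v set" where
  "orthogonal_set S = {v \<in> \<Union>g. P g. \<forall>y \<in> S. orthogonal v y}"

lemma orthogonal_set_closed:
  assumes "S \<subseteq> (\<Union>g. P g)" "x \<in> orthogonal_set S" "y \<in> orthogonal_set S"
  shows "br x y \<in> orthogonal_set S" "mul x y \<in> orthogonal_set S"
proof -
  obtain g h where x: "x \<in> P g" and y: "y \<in> P h"
    using assms(2,3) by (auto simp: orthogonal_set_def)
  have "orthogonal (br x y) z \<and> orthogonal (mul x y) z" if z: "z \<in> S" for z
  proof -
    obtain l where l: "z \<in> P l" using assms(1) z by blast
    have "orthogonal x z" "orthogonal y z" using assms(2,3) z by (simp_all add: orthogonal_set_def)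
    then show ?thesis using orthogonal_br[OF x y l] orthogonal_mul[OF x y l] by simp
  qed
  then show "br x y \<in> orthogonal_set S" "mul x y \<in> orthogonal_set S"
    using br_degree[OF x y] mul_degree[OF x y] unfolding orthogonal_set_def by blast+
qed

lemma orthogonal_all_imp_zero:
  assumes "centerless br mul" "\<And>g y. y \<in> P g \<Longrightarrow> orthogonal x y"
  shows "x = 0"
proof -
  have "orthogonal x y" for y
    by (rule orthogonal_span[where S = "\<Union>g. P g"]) (use assms(2) span_components in auto)
  then have "x \<in> pca_center br mul" by (simp add: pca_center_def orthogonal_def)
  with assms(1) show ?thesis by (simp add: centerless_def)
qed

section \<open>Tight components and ideals\<close>

lemma component_zero_outside_support:
  "g \<notin> restricted_support P g0 \<Longrightarrow> g \<notin> {0, g0, - g0} \<Longrightarrow> P g = {0}"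
  by (auto simp: restricted_support_def)

text \<open>The way tightness is applied throughout: membership of \<open>P \<alpha>\<close> in a
  subspace reduces to products of single elements, with the degree conditions in additive
  form.\<close>

lemma tight_component_subset:
  assumes "tight scale P g0 br mul \<alpha>" "subspace V"
    and br: "\<And>h p x y. h \<in> tight_support P g0 \<Longrightarrow> p \<in> tight_support P g0 \<Longrightarrow> h + p + g0 = \<alpha>
          \<Longrightarrow> x \<in> P h \<Longrightarrow> y \<in> P p \<Longrightarrow> br x y \<in> V"
    and mul: "\<And>h p x y. h \<in> tight_support P g0 \<Longrightarrow> p \<in> tight_support P g0 \<Longrightarrow> h + p = \<alpha>
          \<Longrightarrow> x \<in> P h \<Longrightarrow> y \<in> P p \<Longrightarrow> mul x y \<in> V"
  shows "P \<alpha> \<subseteq> V"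
proof -
  have "span_prod scale br (P h) (P p) \<subseteq> V"
    if "h \<in> tight_support P g0" "p \<in> tight_support P g0" "p = - h - g0 + \<alpha>" for h p
    by (rule span_prod_subsetI[OF assms(2)]) (rule br[of h p], use that in auto)
  moreover have "span_prod scale mul (P h) (P p) \<subseteq> V"
    if "h \<in> tight_support P g0" "p \<in> tight_support P g0" "p = - h + \<alpha>" for h p
    by (rule span_prod_subsetI[OF assms(2)]) (rule mul[of h p], use that in auto)
  ultimately show ?thesis
    using assms(1) unfolding tight_def
    by (elim ssubst) (rule span_minimal[OF _ assms(2)], blast)
qed

text \<open>Absorption extends by linearity first from \<open>T\<close> to the whole algebra and
  then from \<open>S\<close> to its span. Homogeneity of \<open>S\<close> makes the span
  graded.\<close>

lemma pca_ideal_spanI: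
  assumes hom: "S \<subseteq> (\<Union>g. P g)" and gen: "span T = UNIV"
    and br: "\<And>s t. s \<in> S \<Longrightarrow> t \<in> T \<Longrightarrow> br s t \<in> span S \<and> br t s \<in> span S"
    and mul: "\<And>s t. s \<in> S \<Longrightarrow> t \<in> T \<Longrightarrow> mul s t \<in> span S \<and> mul t s \<in> span S"
  shows "pca_ideal scale P br mul (span S)"
proof -
  let ?Q = "\<lambda>s t. br s t \<in> span S \<and> br t s \<in> span S \<and> mul s t \<in> span S \<and> mul t s \<in> span S"
  have sub1: "subspace {t. ?Q s t}" for s
    by (auto simp: subspace_def bilinear_simps span_add span_scale span_zero)
  have sub2: "subspace {s. ?Q s t}" for t
    by (auto simp: subspace_def bilinear_simps span_add span_scale span_zero)
  have 1: "?Q s t" if "s \<in> S" for s t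
    using span_minimal[OF _ sub1[of s], of T] gen br mul that by blast
  have Q: "?Q s t" if "s \<in> span S" for s t
    using span_minimal[OF _ sub2[of t], of S] 1 that by blast
  have "span S = span (\<Union>g. span S \<inter> P g)"
  proof
    show "span S \<subseteq> span (\<Union>g. span S \<inter> P g)"
      using hom by (intro span_mono) (auto intro: span_base)
    show "span (\<Union>g. span S \<inter> P g) \<subseteq> span S"
      by (rule span_minimal) auto
  qed
  moreover have "span_prod scale br (span S) B \<subseteq> span S" "span_prod scale br B (span S) \<subseteq> span S"
    "span_prod scale mul (span S) B \<subseteq> span S" "span_prod scale mul B (span S) \<subseteq> span S" for B
    by (rule span_prod_subsetI[OF subspace_span]; use Q in blast)+
  ultimately show ?thesis
    unfolding pca_ideal_def pca_subalgebra_def graded_subspace_def by (metis subspace_span)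
qed

lemma pca_idealD:
  assumes "pca_ideal scale P br mul I"
  shows "subspace I" "I = span (\<Union>g. I \<inter> P g)"
    "x \<in> I \<Longrightarrow> br x y \<in> I" "x \<in> I \<Longrightarrow> br y x \<in> I" "x \<in> I \<Longrightarrow> mul x y \<in> I" "x \<in> I \<Longrightarrow> mul y x \<in> I"
proof -
  have sub: "span_prod scale br I UNIV \<subseteq> I" "span_prod scale br UNIV I \<subseteq> I"
    "span_prod scale mul I UNIV \<subseteq> I" "span_prod scale mul UNIV I \<subseteq> I"
    and gr: "subspace I" "I = span (\<Union>g. I \<inter> P g)"
    using assms unfolding pca_ideal_def pca_subalgebra_def graded_subspace_def by simp_all
  show "subspace I" "I = span (\<Union>g. I \<inter> P g)" by fact+
  show "br x y \<in> I" "br y x \<in> I" "mul x y \<in> I" "mul y x \<in> I" if "x \<in> I"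
    using that sub[THEN subsetD] by (simp_all add: span_prod_base)
qed

section \<open>Simplicity implies connectedness\<close>

lemma simple_imp_connected:
  assumes sym: "symmetric_support P g0"
    and cless: "centerless br mul"
    and tight: "\<forall>\<beta> \<in> {0, g0, - g0}. tight scale P g0 br mul \<beta>"
    and simple: "pca_simple scale P br mul"
    and g: "g \<in> restricted_support P g0"
    and h: "h \<in> restricted_support P g0"
  shows "support_connected P g0 g h"
proof (rule ccontr)
  let ?R = "restricted_support P g0"
  assume not_con: "\<not> support_connected P g0 g h"
  define C where "C = {u \<in> ?R. support_connected P g0 g u}"
  have gC: "g \<in> C" using g support_connected_refl by (simp add: C_def)
  have hC: "h \<in> ?R - C" using h not_con by (simp add: C_def)
  have neg: "- u \<in> ?R" if "u \<in> ?R" for u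
    using sym that by (simp add: symmetric_support_def)
  have negC: "- u \<in> C" if "u \<in> C" for u
    using that neg by (simp add: C_def support_connected_uminus)
  have step: "w \<in> C"
    if "u \<in> C" "w = u + b + l" "w \<in> ?R" "b \<in> ?R \<union> {0, g0, - g0}" "l \<in> {0, g0, - g0}" for u w b l
    using support_connected_step[OF sym, of g u b l] that by (simp add: C_def)
  \<comment> \<open>The values \<open>0\<close> and \<open>g0\<close> of \<open>l\<close> give the
    degrees of the two products. If \<open>u + w + l\<close> is in the support, it is connected to
    \<open>g\<close>, and subtracting \<open>u\<close> and \<open>l\<close> leads on to
    \<open>w\<close>. If it is \<open>0\<close> or \<open>\<plusminus>g0\<close>, it can serve as
    the added element in a step from \<open>- u\<close> to \<open>w\<close>.\<close>
  have separated: "P (u + w + l) = {0}" if u: "u \<in> C" and w: "w \<in> ?R - C" and l: "l \<in> {0, g0}" for u w l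
  proof (rule component_zero_outside_support)
    have uR: "u \<in> ?R" using u by (simp add: C_def)
    show "u + w + l \<notin> ?R"
    proof
      assume "u + w + l \<in> ?R"
      then have "u + w + l \<in> C" using step[OF u, of "u + w + l" w l] w l by auto
      then have "w \<in> C" using step[of "u + w + l" w "- u" "- l"] w l neg[OF uR] by auto
      with w show False by simp
    qed
    show "u + w + l \<notin> {0, g0, - g0}"
    proof
      assume *: "u + w + l \<in> {0, g0, - g0}"
      have "w \<in> C"
        by (rule step[OF negC[OF u], of _ "u + w + l" "- l"]) (use * w l in auto)
      with w show False by simp
    qed
  qed
  have orth: "orthogonal x y" if "u \<in> C" "w \<in> ?R - C" "x \<in> P u" "y \<in> P w" for u w x y
    using separated[OF that(1,2), of g0] separated[OF that(1,2), of 0]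
      br_degree[OF that(3,4)] mul_degree[OF that(3,4)]
    by (intro orthogonal_homogeneousI[OF that(3,4)]) auto
  \<comment> \<open>\<open>K\<close> contains the components with degree in \<open>C\<close>. Its
    own orthogonal set \<open>L\<close> contains those with degree in the rest of the support. Both
    are closed under products and they annihilate each other.\<close>
  define K where "K = orthogonal_set (\<Union>w \<in> ?R - C. P w)"
  define L where "L = orthogonal_set K"
  have K_hom: "K \<subseteq> (\<Union>g. P g)" by (auto simp: K_def orthogonal_set_def)
  have K_br: "br x y \<in> K" and K_mul: "mul x y \<in> K" if "x \<in> K" "y \<in> K" for x y
    using that unfolding K_def by (intro orthogonal_set_closed; blast)+
  have L_br: "br x y \<in> L" and L_mul: "mul x y \<in> L" if "x \<in> L" "y \<in> L" for x y
    using that K_hom unfolding L_def by (intro orthogonal_set_closed; blast)+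
  have CK: "P u \<subseteq> K" if "u \<in> C" for u
    using that orth by (auto simp: K_def orthogonal_set_def)
  have DL: "P w \<subseteq> L" if "w \<in> ?R - C" for w
    using that orthogonal_sym by (auto simp: K_def L_def orthogonal_set_def)
  have R: "P u \<subseteq> K \<or> P u \<subseteq> L" if "u \<in> ?R" for u
    using that CK DL by blast
  have zero: "0 \<in> K"
    using subspace_0[OF subspace_component]
    by (auto simp: K_def orthogonal_set_def orthogonal_def bilinear_simps)
  \<comment> \<open>Two factors in the same set have their product in that set, and a mixed product
    is zero.\<close>
  have prods: "br x y \<in> span (K \<union> L) \<and> mul x y \<in> span (K \<union> L)"
    if "u \<in> ?R" "w \<in> ?R" "x \<in> P u" "y \<in> P w" for u w x y
  proof -
    have "x \<in> K \<or> x \<in> L" "y \<in> K \<or> y \<in> L" using R that by blast+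
    moreover have "br x y = 0 \<and> mul x y = 0" if "x \<in> K \<and> y \<in> L \<or> x \<in> L \<and> y \<in> K"
      using that by (auto simp: L_def orthogonal_set_def orthogonal_def)
    ultimately show ?thesis using K_br K_mul L_br L_mul
      by (metis UnI1 UnI2 span_base span_zero)
  qed
  have gen: "span (K \<union> L) = UNIV"
  proof -
    have "P a \<subseteq> span (K \<union> L)" for a
    proof (cases "a \<in> {0, g0, - g0}")
      case True
      then have "tight scale P g0 br mul a" using tight by auto
      then show ?thesis
        by (rule tight_component_subset)
           (use prods tight_support_subset[of P g0] in blast)+
    next
      case False
      show ?thesis
      proof (cases "a \<in> ?R")
        case True
        then show ?thesis using R span_superset[of "K \<union> L"] by blast
      next
        case F: False
        show ?thesis using component_zero_outside_support[OF F False] by (simp add: span_zero)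
      qed
    qed
    then have "span (\<Union>g. P g) \<subseteq> span (K \<union> L)"
      by (intro span_minimal) auto
    then show ?thesis using span_components by auto
  qed
  have KL: "br x y = 0 \<and> br y x = 0 \<and> mul x y = 0 \<and> mul y x = 0" if "x \<in> K" "y \<in> L" for x y
    using that by (simp add: L_def orthogonal_set_def orthogonal_def)
  \<comment> \<open>It suffices to multiply by the generators \<open>K \<union> L\<close>:
    \<open>K\<close> is closed under products with itself and is annihilated by
    \<open>L\<close>.\<close>
  have "pca_ideal scale P br mul (span K)"
  proof (rule pca_ideal_spanI[OF _ gen])
    show "K \<subseteq> (\<Union>g. P g)" by (fact K_hom)
  qed (use KL K_br K_mul zero in \<open>auto intro: span_base simp: span_zero\<close>)
  then consider "span K = {0}" | "span K = UNIV"
    using simple by (auto simp: pca_simple_def)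
  then show False
  proof cases
    case 1
    then have "P g \<subseteq> {0}" using CK[OF gC] span_superset[of K] by blast
    then show False using g subspace_0[OF subspace_component[of g]]
      by (auto simp: restricted_support_def)
  next
    case 2
    have "x = 0" if "x \<in> P h" for x
    proof (rule orthogonal_all_imp_zero[OF cless])
      fix y
      show "orthogonal x y"
        by (rule orthogonal_span[of K]) (use 2 that hC in \<open>auto simp: K_def orthogonal_set_def orthogonal_sym[of x]\<close>)
    qed
    then show False using h subspace_0[OF subspace_component[of h]]
      by (auto simp: restricted_support_def)
  qed
qed

section \<open>Connectedness implies simplicity\<close>

lemma ideal_meets_support:
  assumes cless: "centerless br mul"
    and tight: "\<forall>\<beta> \<in> {0, g0, - g0, g0 + g0, - (g0 + g0), - (g0 + g0 + g0)}. tight scale P g0 br mul \<beta>"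
    and I: "pca_ideal scale P br mul I" and ne: "I \<noteq> {0}"
  shows "\<exists>g \<in> restricted_support P g0. \<exists>x \<in> P g. x \<in> I \<and> x \<noteq> 0"
proof (rule ccontr)
  let ?R = "restricted_support P g0"
  let ?S = "{0, g0, - g0}"
  assume "\<not> ?thesis"
  then have none: "x = 0" if "g \<in> ?R" "x \<in> P g" "x \<in> I" for g x
    using that by blast
  have central: "x = 0" if x: "x \<in> I" "x \<in> P a" and a: "a \<in> ?S" for x a
  proof (rule orthogonal_all_imp_zero[OF cless])
    have outside: "z = 0" if "z \<in> I" "z \<in> P b" "b \<notin> ?S" for z b
      using that none component_zero_outside_support[of b] by blast
    \<comment> \<open>Both products lie in \<open>I\<close> and have degree outside
      \<open>?S\<close>, where \<open>I\<close> has no nonzero homogeneous element.\<close>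
    have deg: "orthogonal x y" if "y \<in> P b" "b + a \<notin> ?S" "b + a + g0 \<notin> ?S" for b y
    proof (rule orthogonal_homogeneousI[OF x(2) that(1)])
      show "br x y = 0"
        by (rule outside[of _ "b + a + g0"])
           (use br_degree[OF x(2) that(1)] pca_idealD(3)[OF I x(1)] that in \<open>auto simp: add_ac\<close>)
      show "mul x y = 0"
        by (rule outside[of _ "b + a"])
           (use mul_degree[OF x(2) that(1)] pca_idealD(5)[OF I x(1)] that in \<open>auto simp: add_ac\<close>)
    qed
    let ?T = "{0, g0, - g0, g0 + g0, - (g0 + g0), - (g0 + g0 + g0)}"
    have generic: "orthogonal x y" if "b \<notin> ?T" "y \<in> P b" for b y
      using deg[OF that(2)] near_zero_shift[OF a] that(1) by blast
    \<comment> \<open>The restricted support omits \<open>0\<close> and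
      \<open>\<plusminus>g0\<close>, and the tight support also omits the double and triple
      multiples, so its degrees avoid \<open>?T\<close>.\<close>
    then have generic': "orthogonal y x" if "b \<in> tight_support P g0" "y \<in> P b" for b y
      using that by (auto simp: tight_support_def restricted_support_def orthogonal_sym[of y])
    have orth_products: "br y z \<in> {w. orthogonal x w} \<and> mul y z \<in> {w. orthogonal x w}"
      if "h \<in> tight_support P g0" "p \<in> tight_support P g0" "y \<in> P h" "z \<in> P p" for h p y z
      using orthogonal_br[OF that(3,4) x(2)] orthogonal_mul[OF that(3,4) x(2)] generic' that
      by (simp add: orthogonal_sym[of x])
    have tight_orth: "orthogonal x y" if "tight scale P g0 br mul b" "y \<in> P b" for b y
    proof -
      have "P b \<subseteq> {y. orthogonal x y}"
        by (rule tight_component_subset[OF that(1) subspace_orthogonal])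
           (use orth_products in blast)+
      with that(2) show ?thesis by blast
    qed
    show "orthogonal x y" if "y \<in> P b" for b y
    proof (cases "b \<in> ?T")
      case True
      then show ?thesis using tight tight_orth that by blast
    next
      case False
      then show ?thesis using generic that by blast
    qed
  qed
  have "x = 0" if "x \<in> I" "x \<in> P a" for x a
    using that none central component_zero_outside_support[of a] by blast
  then have "(\<Union>g. I \<inter> P g) \<subseteq> {0}" by blast
  then have "I \<subseteq> {0}"
    using pca_idealD(2)[OF I] span_minimal[OF _ subspace_single_0] by metis
  with ne pca_idealD(1)[OF I] show False using subspace_0 by blast
qed

text \<open>Multiplicativity gives a nonzero product of degree \<open>u + b + l\<close>. It lies in
  \<open>I\<close> as soon as one factor does, and its component is one-dimensional.\<close>

lemma support_multiplicative_ideal_step: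
  assumes mult: "support_multiplicative scale P g0 br mul"
    and max: "maximal_length scale P g0"
    and I: "pca_ideal scale P br mul I"
    and u: "u \<in> restricted_support P g0"
    and b: "b \<in> restricted_support P g0 \<union> {0, g0, - g0}"
    and l: "l \<in> {0, g0, - g0}"
    and w: "u + b + l \<in> restricted_support P g0"
    and sub: "P u \<subseteq> I \<or> P b \<subseteq> I"
  shows "P (u + b + l) \<subseteq> I"
proof -
  note ideal = pca_idealD[OF I]
  note m = mult[unfolded support_multiplicative_def, rule_format, OF u b l w]
  have "\<exists>z. z \<in> P (u + b + l) \<and> z \<noteq> 0 \<and> z \<in> I"
  proof -
    consider "l = 0" | "l = g0" | "l = - g0" using l by auto
    then show ?thesis
    proof cases
      case 1
      then obtain x y where "x \<in> P u" "y \<in> P b" "mul x y \<noteq> 0"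
        using m span_prod_nonzeroE by metis
      then show ?thesis using 1 mul_degree[of x u y b] sub ideal by (intro exI[of _ "mul x y"]) auto
    next
      case 2
      then obtain x y where "x \<in> P u" "y \<in> P b" "br x y \<noteq> 0"
        using m span_prod_nonzeroE by metis
      then show ?thesis using 2 br_degree[of x u y b] sub ideal by (intro exI[of _ "br x y"]) auto
    next
      case 3
      then obtain v z where v: "v \<in> span_prod scale mul (P u) (P b)" and z: "z \<in> P (- g0)" "mul v z \<noteq> 0"
        using m span_prod_nonzeroE by metis
      \<comment> \<open>For \<open>l = - g0\<close> the left factor is an element of a span of
        products, so its degree and its membership in \<open>I\<close> are established for the whole
        span.\<close>
      have "span_prod scale mul (P u) (P b) \<subseteq> P (u + b) \<inter> I"
        by (rule span_prod_subsetI)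
           (use sub ideal mul_degree in \<open>auto intro: subspace_inter subspace_component\<close>)
      then show ?thesis using 3 v z mul_degree[of v "u + b" z "- g0"] ideal
        by (intro exI[of _ "mul v z"]) auto
    qed
  qed
  moreover have "dim (P (u + b + l)) = 1"
    using max w by (simp add: maximal_length_def)
  ultimately show ?thesis using dim_one_subset ideal(1) by metis
qed

text \<open>All partial sums of a connection lie in the support, so membership in \<open>I\<close>
  passes from each to the next. The last sum is \<open>h\<close> only up to sign, hence the
  disjunction.\<close>

lemma connected_ideal:
  assumes sym: "symmetric_support P g0"
    and mult: "support_multiplicative scale P g0 br mul"
    and max: "maximal_length scale P g0"
    and I: "pca_ideal scale P br mul I"
    and g: "g \<in> restricted_support P g0"
    and h: "h \<in> restricted_support P g0"
    and con: "support_connected P g0 g h"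
    and sub: "P g \<subseteq> I"
  shows "P h \<subseteq> I \<or> P (- h) \<subseteq> I"
proof -
  let ?R = "restricted_support P g0"
  have pm: "pm_support P g0 = ?R"
    using sym by (rule pm_support_symmetric)
  obtain n :: nat and a k :: "nat \<Rightarrow> 'g" where n: "n \<ge> 1"
    and a: "\<forall>i \<in> {1..n}. a i \<in> ?R \<union> {0, g0, - g0}"
    and k: "\<forall>i \<in> {2..n}. k i \<in> {0, g0, - g0}"
    and a1: "a 1 = g"
    and mid: "\<forall>m \<in> {2..n - 1}. a 1 + (\<Sum>i = 2..m. a i + k i) \<in> ?R"
    and last: "a 1 + (\<Sum>i = 2..n. a i + k i) \<in> {h, - h}"
    using con unfolding support_connected_def pm by blast
  define s where "s m = a 1 + (\<Sum>i = 2..m. a i + k i)" for m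
  have sR: "s m \<in> ?R" if "m \<ge> 1" "m \<le> n" for m
  proof -
    \<comment> \<open>The definition of a connection constrains only the sums strictly between the
      ends. The ends are in the support by the choice of \<open>g\<close> and by symmetry for
      \<open>\<plusminus>h\<close>.\<close>
    consider "m = 1" | "m = n" | "m \<in> {2..n - 1}" using \<open>m \<ge> 1\<close> \<open>m \<le> n\<close> by fastforce
    then show ?thesis
    proof cases
      case 1
      then show ?thesis using a1 g by (simp add: s_def)
    next
      case 2
      then show ?thesis using last h sym by (auto simp: s_def symmetric_support_def)
    next
      case 3
      then show ?thesis using mid by (simp add: s_def)
    qed
  qed
  have "P (s m) \<subseteq> I" if "m \<ge> 1" "m \<le> n" for m
    using that
  proof (induction m rule: nat_induct_at_least)
    case base
    then show ?case using sub a1 by (simp add: s_def)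
  next
    case (Suc m)
    have eq: "s (Suc m) = s m + a (Suc m) + k (Suc m)"
      using Suc.hyps by (simp add: s_def add.assoc)
    show ?case unfolding eq
    proof (rule support_multiplicative_ideal_step[OF mult max I])
      show "s m + a (Suc m) + k (Suc m) \<in> ?R"
        using sR[of "Suc m"] Suc.prems by (simp add: eq)
    qed (use Suc sR[of m] a k in auto)
  qed
  then have "P (s n) \<subseteq> I" using n by simp
  then show ?thesis using last by (auto simp: s_def)
qed

lemma connected_imp_simple:
  assumes sym: "symmetric_support P g0"
    and cless: "centerless br mul"
    and mult: "support_multiplicative scale P g0 br mul"
    and max: "maximal_length scale P g0"
    and tight: "\<forall>\<beta> \<in> {0, g0, - g0, g0 + g0, - (g0 + g0), - (g0 + g0 + g0)}. tight scale P g0 br mul \<beta>"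
    and con: "\<forall>g \<in> restricted_support P g0. \<forall>h \<in> restricted_support P g0. support_connected P g0 g h"
  shows "pca_simple scale P br mul"
proof -
  let ?R = "restricted_support P g0"
  have neg: "- u \<in> ?R" if "u \<in> ?R" for u
    using sym that by (simp add: symmetric_support_def)
  have "?R \<noteq> {}"
  proof
    assume "?R = {}"
    \<comment> \<open>Tightness would write \<open>P 0\<close> as an empty sum, against
      \<open>P 0 \<noteq> {0}\<close> in maximal length.\<close>
    then have "P 0 \<subseteq> {0}"
      using tight tight_support_subset[of P g0]
      by (intro tight_component_subset subspace_single_0) auto
    then show False using max subspace_0[OF subspace_component[of 0]]
      by (auto simp: maximal_length_def)
  qed
  then obtain g where g: "g \<in> ?R" by blast
  \<comment> \<open>Adding \<open>0 + 0\<close>, and below \<open>- g0 + g0\<close>, returns to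
    degree \<open>g\<close>. Multiplicativity then yields a nonzero associative product and a
    nonzero bracket.\<close>
  have "span_prod scale mul (P g) (P 0) \<noteq> {0}"
    using mult[unfolded support_multiplicative_def, rule_format, OF g, of 0 0] g by simp
  then have "span_prod scale mul UNIV UNIV \<noteq> {0}"
    by (rule span_prod_nonzeroE) (rule span_prod_nonzeroI, auto)
  moreover have "span_prod scale br (P g) (P (- g0)) \<noteq> {0}"
    using mult[unfolded support_multiplicative_def, rule_format, OF g, of "- g0" g0] g by simp
  then have "span_prod scale br UNIV UNIV \<noteq> {0}"
    by (rule span_prod_nonzeroE) (rule span_prod_nonzeroI, auto)
  moreover have "I = UNIV" if I: "pca_ideal scale P br mul I" and ne: "I \<noteq> {0}" for I
  proof -
    note ideal = pca_idealD[OF I]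
    obtain u x where u: "u \<in> ?R" "x \<in> P u" "x \<in> I" "x \<noteq> 0"
      using ideal_meets_support[OF cless tight I ne] by blast
    then have "P u \<subseteq> I"
      using max ideal(1) by (intro dim_one_subset[of _ x]) (auto simp: maximal_length_def)
    then have half: "P h \<subseteq> I \<or> P (- h) \<subseteq> I" if "h \<in> ?R" for h
      using connected_ideal[OF sym mult max I u(1) that] con u(1) that by blast
    have "P 0 \<subseteq> I"
    proof (rule tight_component_subset[OF _ ideal(1)])
      show "tight scale P g0 br mul 0" using tight by blast
      fix h p x y
      assume "h \<in> tight_support P g0" "p \<in> tight_support P g0"
      then have hp: "h \<in> ?R" "p \<in> ?R" using tight_support_subset by blast+
      assume xy: "x \<in> P h" "y \<in> P p"
      show "mul x y \<in> I" if "h + p = 0"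
      proof -
        have "p = - h" using that by (simp add: eq_neg_iff_add_eq_0 add.commute)
        then show ?thesis using half[OF hp(1)] xy ideal by blast
      qed
      show "br x y \<in> I" if "h + p + g0 = 0"
      proof -
        have p: "p = - h + 0 + - g0"
          using that by (simp add: algebra_simps eq_neg_iff_add_eq_0)
        \<comment> \<open>If only \<open>P (- h)\<close> is known to lie in \<open>I\<close>, a step
          from \<open>- h\<close> with added degree \<open>0\<close> and shift \<open>- g0\<close>
          reaches \<open>p\<close>, so the second factor of the bracket lies in
          \<open>I\<close>.\<close>
        have "P p \<subseteq> I" if "P (- h) \<subseteq> I"
          unfolding p
          by (rule support_multiplicative_ideal_step[OF mult max I])
             (use hp neg that p in auto)
        then show ?thesis using half[OF hp(1)] xy ideal by blast
      qed
    qed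
    \<comment> \<open>Here the factor in \<open>I\<close> is the second one, \<open>P 0\<close>, and
      the step from \<open>h\<close> by \<open>0 + 0\<close> stays at \<open>h\<close>.\<close>
    then have R: "P h \<subseteq> I" if "h \<in> ?R" for h
      using support_multiplicative_ideal_step[OF mult max I, of h 0 0] that by simp
    have "P a \<subseteq> I" for a
    proof (cases "a \<in> {0, g0, - g0}")
      case True
      then have "tight scale P g0 br mul a" using tight by auto
      then show ?thesis
        by (rule tight_component_subset[OF _ ideal(1)])
           (use R tight_support_subset ideal in blast)+
    next
      case False
      then show ?thesis
        using R[of a] component_zero_outside_support[of a] subspace_0[OF ideal(1)]
        by (cases "a \<in> ?R") auto
    qed
    then have "span (\<Union>g. P g) \<subseteq> I"
      using ideal(1) by (intro span_minimal) auto
    then show ?thesis using span_components by auto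
  qed
  ultimately show ?thesis unfolding pca_simple_def by blast
qed

end

theorem theorem3:
  fixes scale :: "'k::field \<Rightarrow> 'v::ab_group_add \<Rightarrow> 'v"
    and P :: "'g::ab_group_add \<Rightarrow> 'v set"
    and \<epsilon> :: "'g \<Rightarrow> 'g \<Rightarrow> 'k"
    and g0 :: 'g
    and br mul :: "'v \<Rightarrow> 'v \<Rightarrow> 'v"
  assumes "free_of_two_torsion TYPE('g)"
    and "poisson_color_algebra scale P \<epsilon> g0 br mul"
    and "symmetric_support P g0"
    and "centerless br mul"
    and "support_multiplicative scale P g0 br mul"
    and "maximal_length scale P g0"
    and "\<forall>\<beta> \<in> {0, g0, - g0, g0 + g0, - (g0 + g0), - (g0 + g0 + g0)}. tight scale P g0 br mul \<beta>"
  shows "pca_simple scale P br mul \<longleftrightarrow>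
    (\<forall>g \<in> restricted_support P g0. \<forall>h \<in> restricted_support P g0. support_connected P g0 g h)"
proof -
  interpret poisson_color_algebra scale P \<epsilon> g0 br mul by fact
  show ?thesis
    using simple_imp_connected[OF assms(3,4)] connected_imp_simple[OF assms(3-7)] assms(7)
    by blast
qed

end
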